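(* Let $f$ and $f'$ be complex valued functions on a finite group $G$, and let $\mathcal{R}$ be a complete set of inequivalent irreducible unitary complex matrix representations of $G$. Assume that the Fourier matrix $\hat f(\rho)=\sum_{x\in G}\rho(x) f(x)$ is invertible for all $\rho\in\mathcal{R}$. Let $\hat q_z(\rho)$ and $\hat q'_z(\rho)$ ($z\in G$, $\rho\in\mathcal{R}$) denote the skew spectra of $f$ and $f'$ respectively. Then there exists $t\in G$ such that $f'(x)=f(t^{-1}x)$ for all $x\in G$ if and only if $\hat q'_z(\rho)=\hat q_z(\rho)$ for all $z\in G$ and all $\rho\in\mathcal{R}$.
   Context: $G$ is a finite group. A complete set $\mathcal{R}$ of inequivalent irreducible unitary matrix representations contains exactly one representative $\rho\colon G\to\mathbb{C}^{d_\rho\times d_\rho}$ of each isomorphism class of irreducible complex representations, each chosen so that $\rho(x^{-1})=\rho(x)^\dagger$, where $\dagger$ denotes conjugate transpose. The Fourier transform of a function $g\colon G\to\mathbb{C}$ is the collection of matrices $\hat g(\rho)=\sum_{x\in G}\rho(x)\,g(x)$, $\rho\in\mathcal{R}$. Skew spectrum: for $f\colon G\to\mathbb{C}$ and $z\in G$ define $r_z\colon G\to\mathbb{C}$ by $r_z(x)=f(x)\,f(xz)$. The skew spectrum of $f$ is the collection of matrices $\hat q_z(\rho)=\hat r_z(\rho)^\dagger\,\hat f(\rho)$, for $z\in G$ and $\rho\in\mathcal{R}$. *)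

theory Defs
  imports "Jordan_Normal_Form.Schur_Decomposition"
begin

text \<open>A complex matrix representation is a function into matrices of one fixed size; the size
  is not part of the type and is read off from the image of the identity.  Values
  of functions outside \<open>carrier G\<close> are irrelevant.\<close>

definition rep_dim :: "('a, 'b) monoid_scheme \<Rightarrow> ('a \<Rightarrow> complex mat) \<Rightarrow> nat" where
  "rep_dim G \<rho> = dim_row (\<rho> \<one>\<^bsub>G\<^esub>)"

definition matrix_rep :: "('a, 'b) monoid_scheme \<Rightarrow> ('a \<Rightarrow> complex mat) \<Rightarrow> bool" where
  "matrix_rep G \<rho> \<longleftrightarrow>
     \<rho> \<in> hom G (units_of (ring_mat TYPE(complex) (rep_dim G \<rho>) ()))"

definition irreducible_rep :: "('a, 'b) monoid_scheme \<Rightarrow> ('a \<Rightarrow> complex mat) \<Rightarrow> bool" where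
  "irreducible_rep G \<rho> \<longleftrightarrow>
     matrix_rep G \<rho> \<and> rep_dim G \<rho> > 0 \<and>
     (\<forall>W. VectorSpace.subspace class_ring W (module_vec TYPE(complex) (rep_dim G \<rho>)) \<and>
          (\<forall>x\<in>carrier G. \<forall>v\<in>W. \<rho> x *\<^sub>v v \<in> W) \<longrightarrow>
          W = {0\<^sub>v (rep_dim G \<rho>)} \<or> W = carrier_vec (rep_dim G \<rho>))"

definition unitary_rep :: "('a, 'b) monoid_scheme \<Rightarrow> ('a \<Rightarrow> complex mat) \<Rightarrow> bool" where
  "unitary_rep G \<rho> \<longleftrightarrow>
     matrix_rep G \<rho> \<and> (\<forall>x\<in>carrier G. \<rho> (inv\<^bsub>G\<^esub> x) = mat_adjoint (\<rho> x))"

text \<open>The base change \<open>P\<close>, with inverse \<open>Q\<close>, does not depend on the group element.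
  The constant \<open>similar_mat_wit\<close> also forces both representations to have the same dimension.\<close>

definition equivalent_reps ::
  "('a, 'b) monoid_scheme \<Rightarrow> ('a \<Rightarrow> complex mat) \<Rightarrow> ('a \<Rightarrow> complex mat) \<Rightarrow> bool" where
  "equivalent_reps G \<rho> \<sigma> \<longleftrightarrow>
     (\<exists>P Q. \<forall>x\<in>carrier G. similar_mat_wit (\<rho> x) (\<sigma> x) P Q)"

text \<open>The isomorphism classes range over all irreducible representations \<open>\<sigma>\<close>, unitary or not.\<close>

definition complete_unitary_irreps ::
  "('a, 'b) monoid_scheme \<Rightarrow> ('a \<Rightarrow> complex mat) set \<Rightarrow> bool" where
  "complete_unitary_irreps G R \<longleftrightarrow>
     (\<forall>\<rho>\<in>R. irreducible_rep G \<rho> \<and> unitary_rep G \<rho>) \<and>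
     (\<forall>\<sigma>. irreducible_rep G \<sigma> \<longrightarrow> (\<exists>!\<rho>. \<rho> \<in> R \<and> equivalent_reps G \<sigma> \<rho>))"

text \<open>The matrix sum is written entrywise, since matrices of varying size do not form
  an additive monoid at the level of types.\<close>

definition fourier ::
  "('a, 'b) monoid_scheme \<Rightarrow> ('a \<Rightarrow> complex) \<Rightarrow> ('a \<Rightarrow> complex mat) \<Rightarrow> complex mat" where
  "fourier G g \<rho> =
     mat (rep_dim G \<rho>) (rep_dim G \<rho>) (\<lambda>(i, j). \<Sum>x\<in>carrier G. \<rho> x $$ (i, j) * g x)"

definition skew_product ::
  "('a, 'b) monoid_scheme \<Rightarrow> ('a \<Rightarrow> complex) \<Rightarrow> 'a \<Rightarrow> 'a \<Rightarrow> complex" where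
  "skew_product G f z x = f x * f (x \<otimes>\<^bsub>G\<^esub> z)"

definition skew_spectrum ::
  "('a, 'b) monoid_scheme \<Rightarrow> ('a \<Rightarrow> complex) \<Rightarrow> 'a \<Rightarrow> ('a \<Rightarrow> complex mat) \<Rightarrow> complex mat" where
  "skew_spectrum G f z \<rho> =
     mat_adjoint (fourier G (skew_product G f z) \<rho>) * fourier G f \<rho>"

end

theory Submission
  imports Defs
begin

text \<open>By unitarity, \<open>q\<^sub>z\<close> is the Fourier transform of the triple correlation
  \<open>u \<mapsto> \<Sum>x. cnj (f x) * cnj (f (x z)) * f (x u)\<close>, so by injectivity of the Fourier transform the
  skew spectrum carries the same information as the trilinear form
  \<open>\<Sum>x. cnj (f (x z)) * cnj (f (x w)) * f (x u)\<close>. Invertibility of all Fourier matrices means that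
  the matrix \<open>(f (x u))\<close> is invertible. Writing \<open>(f' (x u)) = A (f (x u))\<close> and cancelling this matrix,
  equality of the two forms becomes
  \<open>\<Sum>x. cnj (A x p) * cnj (A x q) * A x r = (if p = q = r then 1 else 0)\<close>, which forces \<open>A\<close> to be
  a permutation matrix. Its row at the identity exhibits \<open>f'\<close> as a translate of \<open>f\<close>, and no
  reconstruction of group elements from representations (Tannaka--Krein) is needed.\<close>

subsection \<open>Matrices\<close>

lemma index_mult_mat_sum:
  assumes "A \<in> carrier_mat n m" "B \<in> carrier_mat m k" "i < n" "j < k"
  shows "(A * B) $$ (i, j) = (\<Sum>l<m. A $$ (i, l) * B $$ (l, j))"
  using assms by (auto simp: scalar_prod_def atLeast0LessThan intro!: sum.cong)

lemma index_mult_mat_vec_sum: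
  assumes "A \<in> carrier_mat n m" "v \<in> carrier_vec m" "i < n"
  shows "(A *\<^sub>v v) $ i = (\<Sum>l<m. A $$ (i, l) * v $ l)"
  using assms by (auto simp: scalar_prod_def atLeast0LessThan intro!: sum.cong)

lemma mat_adjoint_index:
  fixes A :: "complex mat"
  assumes "A \<in> carrier_mat n m" "i < m" "j < n"
  shows "mat_adjoint A $$ (i, j) = cnj (A $$ (j, i))"
  using assms by (auto simp: mat_adjoint_def mat_of_rows_def)

lemma mat_adjoint_carrier:
  fixes A :: "complex mat"
  assumes "A \<in> carrier_mat n m"
  shows "mat_adjoint A \<in> carrier_mat m n"
  using assms by (auto simp: mat_adjoint_def)

definition mat_trace :: "'a::comm_monoid_add mat \<Rightarrow> 'a" where
  "mat_trace A = (\<Sum>i<dim_row A. A $$ (i, i))"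

lemma mat_trace_comm:
  fixes A B :: "'a::comm_semiring_0 mat"
  assumes "A \<in> carrier_mat n m" "B \<in> carrier_mat m n"
  shows "mat_trace (A * B) = mat_trace (B * A)"
proof -
  have "mat_trace (A * B) = (\<Sum>i<n. \<Sum>l<m. A $$ (i, l) * B $$ (l, i))"
    using assms by (auto simp: mat_trace_def index_mult_mat_sum[OF assms] simp del: index_mult_mat(1))
  also have "\<dots> = (\<Sum>l<m. \<Sum>i<n. B $$ (l, i) * A $$ (i, l))"
    by (subst sum.swap) (simp add: mult.commute)
  also have "\<dots> = mat_trace (B * A)"
    using assms
    by (auto simp: mat_trace_def index_mult_mat_sum[OF assms(2,1)] simp del: index_mult_mat(1))
  finally show ?thesis .
qed

text \<open>The trace is cyclic. Consequently the character
  \<open>x \<mapsto> mat_trace (\<sigma> x)\<close> of a representation is unchanged by a base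
  change.\<close>

lemma mat_trace_conj:
  fixes A P Q :: "'a::comm_semiring_1 mat"
  assumes "A \<in> carrier_mat n n" "P \<in> carrier_mat n n" "Q \<in> carrier_mat n n" "Q * P = 1\<^sub>m n"
  shows "mat_trace (P * A * Q) = mat_trace A"
proof -
  have "mat_trace (P * A * Q) = mat_trace (Q * (P * A))"
    using assms by (intro mat_trace_comm[of _ n n]) auto
  also have "Q * (P * A) = (Q * P) * A"
    using assms by (intro assoc_mult_mat[symmetric, of _ n n _ n _ n]) auto
  finally show ?thesis using assms by simp
qed

section \<open>Inverses of matrices and of kernels on a finite set\<close>

lemma det_nonzero_obtain_inverse:
  fixes A :: "'a::field mat"
  assumes "A \<in> carrier_mat n n" "det A \<noteq> 0"
  obtains B where "B \<in> carrier_mat n n" "A * B = 1\<^sub>m n" "B * A = 1\<^sub>m n"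
  using det_non_zero_imp_unit[OF assms, of "()"]
  by (auto simp: Units_def ring_mat_simps)

text \<open>An enumeration of \<open>X\<close> reduces this to square matrices, where a trivial
  kernel gives a nonzero determinant and hence a two-sided inverse. Stating it for functions on
  \<open>X\<close> lets group elements serve directly as indices later.\<close>

lemma kernel_trivial_obtain_inverse:
  fixes k :: "'a \<Rightarrow> 'a \<Rightarrow> 'b::field"
  assumes fin: "finite X"
    and inj: "\<And>a x. (\<And>u. u \<in> X \<Longrightarrow> (\<Sum>x\<in>X. a x * k x u) = 0) \<Longrightarrow> x \<in> X \<Longrightarrow> a x = 0"
  obtains L where
    "\<And>x y. x \<in> X \<Longrightarrow> y \<in> X \<Longrightarrow> (\<Sum>z\<in>X. L x z * k z y) = (if x = y then 1 else 0)"
    "\<And>x y. x \<in> X \<Longrightarrow> y \<in> X \<Longrightarrow> (\<Sum>z\<in>X. k x z * L z y) = (if x = y then 1 else 0)"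
proof -
  let ?n = "card X"
  obtain e where e: "bij_betw e {..<?n} X"
    using ex_bij_betw_nat_finite[OF fin] by (auto simp: atLeast0LessThan)
  define d where "d = the_inv_into {..<?n} e"
  have d: "d x < ?n" "e (d x) = x" if "x \<in> X" for x
    using e that the_inv_into_into[of e "{..<?n}" x "{..<?n}"] f_the_inv_into_f_bij_betw[OF e]
    unfolding d_def bij_betw_def by auto
  have de: "d (e i) = i" if "i < ?n" for i
    using e that unfolding d_def bij_betw_def by (auto intro: the_inv_into_f_f)
  have eX: "e i \<in> X" if "i < ?n" for i using e that unfolding bij_betw_def by auto
  \<comment> \<open>\<open>K\<close> is the transpose of \<open>k\<close>: a relation among the rows
    of \<open>k\<close> then becomes a null vector of \<open>K\<close>. The definition of
    \<open>L\<close> transposes back.\<close>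
  define K where "K = mat ?n ?n (\<lambda>(i, j). k (e j) (e i))"
  have K: "K \<in> carrier_mat ?n ?n" by (simp add: K_def)
  have "det K \<noteq> 0"
  proof
    assume "det K = 0"
    then obtain v where v: "v \<in> carrier_vec ?n" "v \<noteq> 0\<^sub>v ?n" "K *\<^sub>v v = 0\<^sub>v ?n"
      using det_0_iff_vec_prod_zero[OF K] by blast
    have "(\<Sum>x\<in>X. v $ d x * k x u) = 0" if u: "u \<in> X" for u
    proof -
      have "(\<Sum>x\<in>X. v $ d x * k x u) = (\<Sum>j<?n. v $ d (e j) * k (e j) u)"
        by (rule sum.reindex_bij_betw[OF e, symmetric])
      also have "\<dots> = (\<Sum>j<?n. K $$ (d u, j) * v $ j)"
        using d[OF u] by (intro sum.cong) (auto simp: de K_def)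
      also have "\<dots> = (K *\<^sub>v v) $ d u"
        by (rule index_mult_mat_vec_sum[OF K v(1) d(1)[OF u], symmetric])
      finally show ?thesis using v(3) d(1)[OF u] by simp
    qed
    hence "v $ d x = 0" if "x \<in> X" for x using inj[of "\<lambda>x. v $ d x"] that by blast
    hence "v $ i = 0" if "i < ?n" for i using eX[OF that] de[OF that] by metis
    hence "v = 0\<^sub>v ?n" using v(1) by (intro eq_vecI) auto
    with v(2) show False by contradiction
  qed
  then obtain M where M: "M \<in> carrier_mat ?n ?n" "K * M = 1\<^sub>m ?n" "M * K = 1\<^sub>m ?n"
    using det_nonzero_obtain_inverse[OF K] by blast
  define L where "L x y = M $$ (d y, d x)" for x y
  have eqd: "d y = d x \<longleftrightarrow> x = y" if "x \<in> X" "y \<in> X" for x y using d that by metis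
  have "(\<Sum>z\<in>X. L x z * k z y) = (if x = y then 1 else 0)" if xy: "x \<in> X" "y \<in> X" for x y
  proof -
    have "(\<Sum>z\<in>X. L x z * k z y) = (\<Sum>j<?n. L x (e j) * k (e j) y)"
      by (rule sum.reindex_bij_betw[OF e, symmetric])
    also have "\<dots> = (\<Sum>j<?n. K $$ (d y, j) * M $$ (j, d x))"
      using d xy by (intro sum.cong) (auto simp: de K_def L_def)
    also have "\<dots> = (K * M) $$ (d y, d x)"
      by (rule index_mult_mat_sum[OF K M(1) d(1)[OF xy(2)] d(1)[OF xy(1)], symmetric])
    finally show ?thesis using M(2) d xy eqd by auto
  qed
  moreover have "(\<Sum>z\<in>X. k x z * L z y) = (if x = y then 1 else 0)"
    if xy: "x \<in> X" "y \<in> X" for x y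
  proof -
    have "(\<Sum>z\<in>X. k x z * L z y) = (\<Sum>j<?n. k x (e j) * L (e j) y)"
      by (rule sum.reindex_bij_betw[OF e, symmetric])
    also have "\<dots> = (\<Sum>j<?n. M $$ (d y, j) * K $$ (j, d x))"
      using d xy by (intro sum.cong) (auto simp: de K_def L_def)
    also have "\<dots> = (M * K) $$ (d y, d x)"
      by (rule index_mult_mat_sum[OF M(1) K d(1)[OF xy(2)] d(1)[OF xy(1)], symmetric])
    finally show ?thesis using M(3) d xy eqd by auto
  qed
  ultimately show ?thesis by (rule that)
qed

section \<open>Subspaces and bases adapted to them\<close>

lemma subspace_module_vecD:
  fixes W :: "'a::field vec set"
  assumes "VectorSpace.subspace class_ring W (module_vec TYPE('a) n)"
  shows "W \<subseteq> carrier_vec n" "0\<^sub>v n \<in> W"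
    "\<And>v w. v \<in> W \<Longrightarrow> w \<in> W \<Longrightarrow> v + w \<in> W"
    "\<And>c v. v \<in> W \<Longrightarrow> c \<cdot>\<^sub>v v \<in> W"
proof -
  interpret submodule class_ring W "module_vec TYPE('a) n"
    using assms by (simp add: VectorSpace.subspace_def)
  show "W \<subseteq> carrier_vec n" "0\<^sub>v n \<in> W"
    using subset zero_closed by (simp_all add: module_vec_simps)
  show "v + w \<in> W" if "v \<in> W" "w \<in> W" for v w
    using m_closed[OF that] by (simp add: module_vec_simps)
  show "c \<cdot>\<^sub>v v \<in> W" if "v \<in> W" for c v
    using smult_closed[OF _ that, of c] by (simp add: module_vec_simps class_ring_simps)
qed

text \<open>The basis vectors of \<open>W\<close> are the columns of \<open>P\<close> with index in \<open>J\<close>. Such a set \<open>J\<close> of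
  maximal size works: by Cramer's rule, a vector of \<open>W\<close> with a nonzero coordinate outside \<open>J\<close>
  could replace the corresponding column.\<close>

lemma obtain_adapted_basis:
  fixes W :: "'a::field vec set"
  assumes W: "VectorSpace.subspace class_ring W (module_vec TYPE('a) n)"
  obtains P Q J where "P \<in> carrier_mat n n" "Q \<in> carrier_mat n n"
    "P * Q = 1\<^sub>m n" "Q * P = 1\<^sub>m n" "J \<subseteq> {..<n}"
    "W = {v \<in> carrier_vec n. \<forall>i<n. i \<notin> J \<longrightarrow> (Q *\<^sub>v v) $ i = 0}"
proof -
  note W' = subspace_module_vecD[OF W]
  define good where "good J \<longleftrightarrow> J \<subseteq> {..<n} \<and>
    (\<exists>P. P \<in> carrier_mat n n \<and> det P \<noteq> 0 \<and> (\<forall>j\<in>J. col P j \<in> W))" for J :: "nat set"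
  have "good {}"
    unfolding good_def by (auto intro!: exI[of _ "1\<^sub>m n"])
  moreover have "\<And>J. good J \<Longrightarrow> card J \<le> n"
    unfolding good_def by (metis card_lessThan card_mono finite_lessThan)
  ultimately obtain J where J: "good J" and maxJ: "\<And>J'. good J' \<Longrightarrow> card J' \<le> card J"
    using ex_has_greatest_nat[of good "{}" card "Suc n"] by (auto simp: less_Suc_eq_le)
  from J obtain P where P: "P \<in> carrier_mat n n" "det P \<noteq> 0"
    and PW: "\<And>j. j \<in> J \<Longrightarrow> col P j \<in> W" and Jn: "J \<subseteq> {..<n}"
    unfolding good_def by auto
  obtain Q where Q: "Q \<in> carrier_mat n n" "P * Q = 1\<^sub>m n" "Q * P = 1\<^sub>m n"
    using det_nonzero_obtain_inverse[OF P] by blast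
  have PQv: "P *\<^sub>v (Q *\<^sub>v v) = v" if "v \<in> carrier_vec n" for v
    using assoc_mult_mat_vec[OF P(1) Q(1) that] Q that by simp
  have "(Q *\<^sub>v w) $ j = 0" if w: "w \<in> W" and j: "j < n" "j \<notin> J" for w j
  proof (rule ccontr)
    assume nz: "(Q *\<^sub>v w) $ j \<noteq> 0"
    have wc: "w \<in> carrier_vec n" using w W' by auto
    define P' where "P' = replace_col P w j"
    have P': "P' \<in> carrier_mat n n" using P unfolding P'_def replace_col_def by auto
    have "det P' = (Q *\<^sub>v w) $ j * det P"
      using cramer_lemma_mat[OF P(1) _ j(1), of "Q *\<^sub>v w"] PQv[OF wc] Q wc
      by (simp add: P'_def)
    hence "det P' \<noteq> 0" using nz P by simp
    moreover have "col P' i \<in> W" if "i \<in> insert j J" for i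
    proof -
      have "i < n" using that j Jn by auto
      hence "col P' i = (if i = j then w else col P i)"
        using P wc j by (auto simp: P'_def replace_col_def)
      thus ?thesis using that w PW by auto
    qed
    ultimately have "good (insert j J)"
      unfolding good_def using P' Jn j by blast
    from maxJ[OF this] show False
      using j Jn finite_subset[OF Jn] by simp
  qed
  moreover have "v \<in> W" if v: "v \<in> carrier_vec n"
    and v0: "\<forall>i<n. i \<notin> J \<longrightarrow> (Q *\<^sub>v v) $ i = 0" for v
  proof -
    define c where "c = Q *\<^sub>v v"
    have c: "c \<in> carrier_vec n" using Q v by (auto simp: c_def)
    \<comment> \<open>\<open>W\<close> is closed under sums of two vectors and under scaling, so
      combinations of the columns in \<open>J\<close> are reached by induction over subsets
      \<open>S\<close> of \<open>J\<close>.\<close>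
    have partial: "vec n (\<lambda>i. \<Sum>j\<in>S. P $$ (i, j) * c $ j) \<in> W" if "finite S" "S \<subseteq> J" for S
      using that
    proof (induction S)
      case empty
      have "vec n (\<lambda>i. \<Sum>j\<in>{}. P $$ (i, j) * c $ j) = 0\<^sub>v n" by auto
      thus ?case using W' by simp
    next
      case (insert k S)
      have "vec n (\<lambda>i. \<Sum>j\<in>insert k S. P $$ (i, j) * c $ j) =
          c $ k \<cdot>\<^sub>v col P k + vec n (\<lambda>i. \<Sum>j\<in>S. P $$ (i, j) * c $ j)"
        using insert P Jn by (intro eq_vecI) (auto simp: subset_iff mult.commute)
      thus ?case using insert W' PW by auto
    qed
    \<comment> \<open>The coordinates \<open>c\<close> vanish outside \<open>J\<close>, so the
      expansion \<open>v = P *\<^sub>v c\<close> involves only columns lying in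
      \<open>W\<close>.\<close>
    have "v = vec n (\<lambda>i. \<Sum>j\<in>J. P $$ (i, j) * c $ j)"
    proof (rule eq_vecI)
      fix i assume i: "i < dim_vec (vec n (\<lambda>i. \<Sum>j\<in>J. P $$ (i, j) * c $ j))"
      have "v $ i = (P *\<^sub>v c) $ i" using PQv[OF v] by (simp add: c_def)
      also have "\<dots> = (\<Sum>j<n. P $$ (i, j) * c $ j)"
        using i by (intro index_mult_mat_vec_sum[OF P(1) c]) simp
      also have "\<dots> = (\<Sum>j\<in>J. P $$ (i, j) * c $ j)"
        using Jn v0 by (intro sum.mono_neutral_right) (auto simp: c_def)
      finally show "v $ i = vec n (\<lambda>i. \<Sum>j\<in>J. P $$ (i, j) * c $ j) $ i" using i by simp
    qed (use v in auto)
    thus ?thesis using partial[of J] finite_subset[OF Jn] by simp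
  qed
  ultimately have "W = {v \<in> carrier_vec n. \<forall>i<n. i \<notin> J \<longrightarrow> (Q *\<^sub>v v) $ i = 0}"
    using W'(1) by blast
  with P Q Jn show ?thesis using that by blast
qed

subsection \<open>Matrix representations\<close>

text \<open>Membership in the unit group is automatic: the value of \<open>\<rho>\<close> at the
  inverse of \<open>x\<close> is a two-sided inverse of \<open>\<rho> x\<close>.\<close>

lemma matrix_repI:
  assumes "group G" and "\<And>x. x \<in> carrier G \<Longrightarrow> \<rho> x \<in> carrier_mat n n"
    and "\<rho> \<one>\<^bsub>G\<^esub> = 1\<^sub>m n"
    and "\<And>x y. x \<in> carrier G \<Longrightarrow> y \<in> carrier G \<Longrightarrow> \<rho> (x \<otimes>\<^bsub>G\<^esub> y) = \<rho> x * \<rho> y"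
  shows "matrix_rep G \<rho>" "rep_dim G \<rho> = n"
proof -
  interpret group G by fact
  show dim: "rep_dim G \<rho> = n" using assms(3) by (simp add: rep_dim_def)
  have "\<rho> x \<in> Units (ring_mat TYPE(complex) n ())" if x: "x \<in> carrier G" for x
    unfolding Units_def using assms(2)[OF x] assms(2)[OF inv_closed[OF x]]
      assms(4)[OF x inv_closed[OF x]] assms(4)[OF inv_closed[OF x] x] x assms(3)
    by (auto simp: ring_mat_simps intro!: bexI[of _ "\<rho> (inv\<^bsub>G\<^esub> x)"])
  thus "matrix_rep G \<rho>"
    unfolding matrix_rep_def dim hom_def
    using assms(4) by (auto simp: units_of_def ring_mat_simps)
qed

lemma matrix_repD:
  assumes "group G" and rep: "matrix_rep G \<rho>"
  shows "\<And>x. x \<in> carrier G \<Longrightarrow> \<rho> x \<in> carrier_mat (rep_dim G \<rho>) (rep_dim G \<rho>)"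
    and "\<And>x y. x \<in> carrier G \<Longrightarrow> y \<in> carrier G \<Longrightarrow> \<rho> (x \<otimes>\<^bsub>G\<^esub> y) = \<rho> x * \<rho> y"
    and "\<rho> \<one>\<^bsub>G\<^esub> = 1\<^sub>m (rep_dim G \<rho>)"
proof -
  interpret group G by fact
  let ?M = "ring_mat TYPE(complex) (rep_dim G \<rho>) ()"
  interpret M: ring ?M by (rule ring_mat)
  interpret U: group "units_of ?M" by (rule M.units_group)
  have hom: "\<rho> \<in> hom G (units_of ?M)" using rep by (simp add: matrix_rep_def)
  show "\<rho> x \<in> carrier_mat (rep_dim G \<rho>) (rep_dim G \<rho>)" if "x \<in> carrier G" for x
    using hom that
    by (auto simp: hom_def Pi_iff units_of_def Units_def ring_mat_simps)
  show "\<rho> (x \<otimes>\<^bsub>G\<^esub> y) = \<rho> x * \<rho> y" if "x \<in> carrier G" "y \<in> carrier G" for x y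
    using hom_mult[OF hom that] by (simp add: units_of_def ring_mat_simps)
  show "\<rho> \<one>\<^bsub>G\<^esub> = 1\<^sub>m (rep_dim G \<rho>)"
    using hom_one[OF hom is_group U.is_group] by (simp add: units_of_def ring_mat_simps)
qed

lemma matrix_rep_conj:
  assumes G: "group G" and rep: "matrix_rep G \<rho>" and n: "rep_dim G \<rho> = n"
    and P: "P \<in> carrier_mat n n" and Q: "Q \<in> carrier_mat n n"
    and PQ: "P * Q = 1\<^sub>m n" "Q * P = 1\<^sub>m n"
  shows "matrix_rep G (\<lambda>x. Q * \<rho> x * P)" "rep_dim G (\<lambda>x. Q * \<rho> x * P) = n"
proof -
  note r = matrix_repD[OF G rep, unfolded n]
  have mult: "Q * \<rho> (x \<otimes>\<^bsub>G\<^esub> y) * P = (Q * \<rho> x * P) * (Q * \<rho> y * P)"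
    if "x \<in> carrier G" "y \<in> carrier G" for x y
  proof -
    note x = r(1)[OF that(1)] and y = r(1)[OF that(2)]
    have "(Q * \<rho> x * P) * (Q * \<rho> y * P) = (Q * \<rho> x) * (P * (Q * (\<rho> y * P)))"
      using P Q x y by (simp add: assoc_mult_mat[of _ n n _ n _ n])
    also have "P * (Q * (\<rho> y * P)) = (P * Q) * (\<rho> y * P)"
      using P Q x y by (intro assoc_mult_mat[symmetric, of _ n n _ n _ n]) auto
    also have "\<dots> = \<rho> y * P" using PQ P y by simp
    also have "(Q * \<rho> x) * (\<rho> y * P) = Q * \<rho> (x \<otimes>\<^bsub>G\<^esub> y) * P"
      unfolding r(2)[OF that] using P Q x y by (simp add: assoc_mult_mat[of _ n n _ n _ n])
    finally show ?thesis by simp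
  qed
  have c: "Q * \<rho> x * P \<in> carrier_mat n n" if "x \<in> carrier G" for x
    using r(1)[OF that] P Q by auto
  have one: "Q * \<rho> \<one>\<^bsub>G\<^esub> * P = 1\<^sub>m n" using r(3) P Q PQ by simp
  show "matrix_rep G (\<lambda>x. Q * \<rho> x * P)" "rep_dim G (\<lambda>x. Q * \<rho> x * P) = n"
    using matrix_repI[OF G, of "\<lambda>x. Q * \<rho> x * P" n] c one mult by auto
qed

text \<open>Under \<open>zero\<close>, the entries of a product with indices in \<open>S\<close>
  receive contributions only from inner indices in \<open>S\<close>, so cutting down to
  \<open>S\<close> stays multiplicative. For block triangular matrices this covers both diagonal
  blocks: for the subrepresentation the second factor in \<open>zero\<close> vanishes, for the
  quotient the first.\<close>

lemma matrix_rep_compress: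
  assumes G: "group G" and rep: "matrix_rep G \<rho>" and n: "rep_dim G \<rho> = n"
    and S: "S \<subseteq> {..<n}"
    and zero: "\<And>x y i j l. \<lbrakk>x \<in> carrier G; y \<in> carrier G; i \<in> S; j \<in> S; l < n; l \<notin> S\<rbrakk>
      \<Longrightarrow> \<rho> x $$ (i, l) * \<rho> y $$ (l, j) = 0"
  obtains \<sigma> where "matrix_rep G \<sigma>" "rep_dim G \<sigma> = card S"
    "\<And>x. x \<in> carrier G \<Longrightarrow> mat_trace (\<sigma> x) = (\<Sum>i\<in>S. \<rho> x $$ (i, i))"
proof -
  note r = matrix_repD[OF G rep, unfolded n]
  have fin: "finite S" using S finite_subset by blast
  obtain e where e: "bij_betw e {..<card S} S"
    using ex_bij_betw_nat_finite[OF fin] by (auto simp: atLeast0LessThan)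
  have eS: "e a \<in> S" "e a < n" if "a < card S" for a
    using e that S unfolding bij_betw_def by auto
  have inj: "e a = e b \<longleftrightarrow> a = b" if "a < card S" "b < card S" for a b
    using e that unfolding bij_betw_def inj_on_def by auto
  define \<sigma> where "\<sigma> x = mat (card S) (card S) (\<lambda>(a, b). \<rho> x $$ (e a, e b))" for x
  have mult: "\<sigma> (x \<otimes>\<^bsub>G\<^esub> y) = \<sigma> x * \<sigma> y" if xy: "x \<in> carrier G" "y \<in> carrier G" for x y
  proof (rule eq_matI)
    fix a b assume "a < dim_row (\<sigma> x * \<sigma> y)" "b < dim_col (\<sigma> x * \<sigma> y)"
    hence ab: "a < card S" "b < card S" by (auto simp: \<sigma>_def)
    have "\<sigma> (x \<otimes>\<^bsub>G\<^esub> y) $$ (a, b) = (\<Sum>l<n. \<rho> x $$ (e a, l) * \<rho> y $$ (l, e b))"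
      using ab r(2)[OF xy] index_mult_mat_sum[OF r(1)[OF xy(1)] r(1)[OF xy(2)], of "e a" "e b"] eS
      by (simp add: \<sigma>_def)
    also have "\<dots> = (\<Sum>l\<in>S. \<rho> x $$ (e a, l) * \<rho> y $$ (l, e b))"
      using S zero xy eS ab by (intro sum.mono_neutral_right) auto
    also have "\<dots> = (\<Sum>c<card S. \<rho> x $$ (e a, e c) * \<rho> y $$ (e c, e b))"
      by (rule sum.reindex_bij_betw[OF e, symmetric])
    also have "\<dots> = (\<sigma> x * \<sigma> y) $$ (a, b)"
      using ab by (subst index_mult_mat_sum[of _ "card S" "card S" _ "card S"])
        (auto simp: \<sigma>_def)
    finally show "\<sigma> (x \<otimes>\<^bsub>G\<^esub> y) $$ (a, b) = (\<sigma> x * \<sigma> y) $$ (a, b)" .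
  qed (auto simp: \<sigma>_def)
  have one: "\<sigma> \<one>\<^bsub>G\<^esub> = 1\<^sub>m (card S)"
    unfolding \<sigma>_def r(3) using eS inj by (intro eq_matI) auto
  have tr: "mat_trace (\<sigma> x) = (\<Sum>i\<in>S. \<rho> x $$ (i, i))" for x
    by (simp add: mat_trace_def \<sigma>_def sum.reindex_bij_betw[OF e, of "\<lambda>i. \<rho> x $$ (i, i)"])
  have "matrix_rep G \<sigma>" "rep_dim G \<sigma> = card S"
    using matrix_repI[OF G, of \<sigma> "card S"] one mult by (auto simp: \<sigma>_def)
  thus ?thesis using tr that by blast
qed


subsection \<open>Fourier transform\<close>

text \<open>Replace \<open>x\<close> by its inverse, then substitute \<open>u = x y\<close>. The
  weight \<open>c\<close> will be an entry of \<open>\<rho>\<close>, which the homomorphism property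
  splits at \<open>x y\<close>.\<close>

lemma sum_convolution_reindex:
  fixes a b c :: "'a \<Rightarrow> complex"
  assumes "group G"
  shows "(\<Sum>u\<in>carrier G. c u * (\<Sum>x\<in>carrier G. a x * b (x \<otimes>\<^bsub>G\<^esub> u))) =
    (\<Sum>x\<in>carrier G. \<Sum>y\<in>carrier G. a (inv\<^bsub>G\<^esub> x) * b y * c (x \<otimes>\<^bsub>G\<^esub> y))"
proof -
  interpret group G by fact
  have inv: "bij_betw (\<lambda>x. inv\<^bsub>G\<^esub> x) (carrier G) (carrier G)"
    by (rule bij_betwI[of _ _ _ "\<lambda>x. inv\<^bsub>G\<^esub> x"]) auto
  have left: "bij_betw (\<lambda>y. x \<otimes>\<^bsub>G\<^esub> y) (carrier G) (carrier G)" if "x \<in> carrier G" for x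
    using that by (intro bij_betwI[of _ _ _ "\<lambda>y. inv\<^bsub>G\<^esub> x \<otimes>\<^bsub>G\<^esub> y"])
      (auto simp: m_assoc[symmetric])
  have "(\<Sum>u\<in>carrier G. c u * (\<Sum>x\<in>carrier G. a x * b (x \<otimes>\<^bsub>G\<^esub> u))) =
      (\<Sum>x\<in>carrier G. \<Sum>u\<in>carrier G. a x * b (x \<otimes>\<^bsub>G\<^esub> u) * c u)"
    unfolding sum_distrib_left by (subst sum.swap) (simp add: mult_ac)
  also have "\<dots> = (\<Sum>x\<in>carrier G. \<Sum>u\<in>carrier G.
      a (inv\<^bsub>G\<^esub> x) * b (inv\<^bsub>G\<^esub> x \<otimes>\<^bsub>G\<^esub> u) * c u)"
    by (rule sum.reindex_bij_betw[OF inv, symmetric])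
  also have "\<dots> = (\<Sum>x\<in>carrier G. \<Sum>y\<in>carrier G. a (inv\<^bsub>G\<^esub> x) * b y * c (x \<otimes>\<^bsub>G\<^esub> y))"
  proof (rule sum.cong[OF refl])
    fix x assume x: "x \<in> carrier G"
    show "(\<Sum>u\<in>carrier G. a (inv\<^bsub>G\<^esub> x) * b (inv\<^bsub>G\<^esub> x \<otimes>\<^bsub>G\<^esub> u) * c u) =
        (\<Sum>y\<in>carrier G. a (inv\<^bsub>G\<^esub> x) * b y * c (x \<otimes>\<^bsub>G\<^esub> y))"
      by (subst sum.reindex_bij_betw[OF left[OF x], symmetric])
        (use x in \<open>auto intro!: sum.cong simp: m_assoc[symmetric]\<close>)
  qed
  finally show ?thesis .
qed

lemma fourier_carrier: "fourier G h \<rho> \<in> carrier_mat (rep_dim G \<rho>) (rep_dim G \<rho>)"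
  by (simp add: fourier_def)

lemma fourier_cong:
  assumes "\<And>x. x \<in> carrier G \<Longrightarrow> g x = h x"
  shows "fourier G g \<rho> = fourier G h \<rho>"
  using assms by (simp add: fourier_def cong: sum.cong)

text \<open>This is the convolution theorem: the function on the left is the convolution of
  \<open>a\<close> composed with inversion and \<open>b\<close>.\<close>

lemma fourier_convolution:
  assumes G: "group G" and rep: "matrix_rep G \<rho>"
  shows "fourier G (\<lambda>u. \<Sum>x\<in>carrier G. a x * b (x \<otimes>\<^bsub>G\<^esub> u)) \<rho> =
    fourier G (\<lambda>x. a (inv\<^bsub>G\<^esub> x)) \<rho> * fourier G b \<rho>"
proof (rule eq_matI)
  let ?n = "rep_dim G \<rho>"
  note r = matrix_repD[OF G rep]
  fix i j
  assume "i < dim_row (fourier G (\<lambda>x. a (inv\<^bsub>G\<^esub> x)) \<rho> * fourier G b \<rho>)"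
    "j < dim_col (fourier G (\<lambda>x. a (inv\<^bsub>G\<^esub> x)) \<rho> * fourier G b \<rho>)"
  hence ij: "i < ?n" "j < ?n" by (auto simp: fourier_def)
  have "fourier G (\<lambda>u. \<Sum>x\<in>carrier G. a x * b (x \<otimes>\<^bsub>G\<^esub> u)) \<rho> $$ (i, j) =
      (\<Sum>x\<in>carrier G. \<Sum>y\<in>carrier G. a (inv\<^bsub>G\<^esub> x) * b y * \<rho> (x \<otimes>\<^bsub>G\<^esub> y) $$ (i, j))"
    using ij by (simp add: fourier_def sum_convolution_reindex[OF G, of "\<lambda>u. \<rho> u $$ (i, j)"])
  also have "\<dots> = (\<Sum>x\<in>carrier G. \<Sum>y\<in>carrier G. \<Sum>l<?n.
      (\<rho> x $$ (i, l) * a (inv\<^bsub>G\<^esub> x)) * (\<rho> y $$ (l, j) * b y))"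
  proof (intro sum.cong refl)
    fix x y assume xy: "x \<in> carrier G" "y \<in> carrier G"
    show "a (inv\<^bsub>G\<^esub> x) * b y * \<rho> (x \<otimes>\<^bsub>G\<^esub> y) $$ (i, j) =
        (\<Sum>l<?n. (\<rho> x $$ (i, l) * a (inv\<^bsub>G\<^esub> x)) * (\<rho> y $$ (l, j) * b y))"
      unfolding r(2)[OF xy] index_mult_mat_sum[OF r(1)[OF xy(1)] r(1)[OF xy(2)] ij]
      by (simp add: sum_distrib_left mult_ac)
  qed
  also have "\<dots> = (\<Sum>l<?n. \<Sum>x\<in>carrier G. \<Sum>y\<in>carrier G.
      (\<rho> x $$ (i, l) * a (inv\<^bsub>G\<^esub> x)) * (\<rho> y $$ (l, j) * b y))"
    by (subst (2) sum.swap, subst sum.swap) (rule refl)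
  also have "\<dots> = (\<Sum>l<?n. fourier G (\<lambda>x. a (inv\<^bsub>G\<^esub> x)) \<rho> $$ (i, l) * fourier G b \<rho> $$ (l, j))"
    using ij by (simp add: fourier_def sum_product)
  also have "\<dots> = (fourier G (\<lambda>x. a (inv\<^bsub>G\<^esub> x)) \<rho> * fourier G b \<rho>) $$ (i, j)"
    by (rule index_mult_mat_sum[OF fourier_carrier fourier_carrier ij, symmetric])
  finally show "fourier G (\<lambda>u. \<Sum>x\<in>carrier G. a x * b (x \<otimes>\<^bsub>G\<^esub> u)) \<rho> $$ (i, j) =
      (fourier G (\<lambda>x. a (inv\<^bsub>G\<^esub> x)) \<rho> * fourier G b \<rho>) $$ (i, j)" .
qed (auto simp: fourier_def)

text \<open>Unitarity moves the adjoint from the matrix to the group element, and reindexing by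
  inversion moves it on to the function. The adjoint in the skew spectrum thereby becomes a Fourier
  transform again.\<close>

lemma fourier_adjoint:
  assumes G: "group G" and rep: "unitary_rep G \<rho>"
  shows "mat_adjoint (fourier G g \<rho>) = fourier G (\<lambda>x. cnj (g (inv\<^bsub>G\<^esub> x))) \<rho>"
proof -
  interpret group G by fact
  let ?n = "rep_dim G \<rho>"
  have inv: "bij_betw (\<lambda>x. inv\<^bsub>G\<^esub> x) (carrier G) (carrier G)"
    by (rule bij_betwI[of _ _ _ "\<lambda>x. inv\<^bsub>G\<^esub> x"]) auto
  have r: "\<And>x. x \<in> carrier G \<Longrightarrow> \<rho> x \<in> carrier_mat ?n ?n"
    "\<And>x. x \<in> carrier G \<Longrightarrow> \<rho> (inv\<^bsub>G\<^esub> x) = mat_adjoint (\<rho> x)"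
    using rep matrix_repD(1)[OF G] unfolding unitary_rep_def by auto
  show ?thesis
  proof (rule eq_matI)
    fix i j assume "i < dim_row (fourier G (\<lambda>x. cnj (g (inv\<^bsub>G\<^esub> x))) \<rho>)"
      "j < dim_col (fourier G (\<lambda>x. cnj (g (inv\<^bsub>G\<^esub> x))) \<rho>)"
    hence ij: "i < ?n" "j < ?n" by (auto simp: fourier_def)
    have "fourier G (\<lambda>x. cnj (g (inv\<^bsub>G\<^esub> x))) \<rho> $$ (i, j) =
        (\<Sum>x\<in>carrier G. \<rho> (inv\<^bsub>G\<^esub> x) $$ (i, j) * cnj (g (inv\<^bsub>G\<^esub> (inv\<^bsub>G\<^esub> x))))"
      unfolding sum.reindex_bij_betw[OF inv, of "\<lambda>x. \<rho> x $$ (i, j) * cnj (g (inv\<^bsub>G\<^esub> x))"]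
      using ij by (simp add: fourier_def)
    also have "\<dots> = cnj (fourier G g \<rho> $$ (j, i))"
      using ij mat_adjoint_index[OF r(1) ij] by (simp add: fourier_def r(2))
    also have "\<dots> = mat_adjoint (fourier G g \<rho>) $$ (i, j)"
      by (rule mat_adjoint_index[OF fourier_carrier ij, symmetric])
    finally show "mat_adjoint (fourier G g \<rho>) $$ (i, j) =
        fourier G (\<lambda>x. cnj (g (inv\<^bsub>G\<^esub> x))) \<rho> $$ (i, j)" ..
  qed (use mat_adjoint_carrier[OF fourier_carrier[of G g \<rho>]] in \<open>auto simp: fourier_def\<close>)
qed

text \<open>The inversion produced by the adjoint is exactly the one in the convolution theorem, so
  the two fit together and no inverse remains.\<close>

lemma skew_spectrum_eq_fourier:
  assumes G: "group G" and rep: "unitary_rep G \<rho>"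
  shows "skew_spectrum G f z \<rho> =
    fourier G (\<lambda>u. \<Sum>x\<in>carrier G. cnj (skew_product G f z x) * f (x \<otimes>\<^bsub>G\<^esub> u)) \<rho>"
  using rep unfolding skew_spectrum_def unitary_rep_def
  by (simp add: fourier_adjoint[OF G rep] fourier_convolution[OF G, where a = "\<lambda>x. cnj (skew_product G f z x)"])

section \<open>Injectivity of the Fourier transform\<close>

text \<open>The representation \<open>\<sigma>\<close> has the same character as some
  \<open>\<rho>\<close> in \<open>R\<close>, and pairing \<open>h\<close> with the character of
  \<open>\<rho>\<close> gives the trace of \<open>fourier G h \<rho>\<close>.\<close>

lemma trace_sum_irreducible:
  assumes G: "group G" and R: "complete_unitary_irreps G R"
    and zero: "\<And>\<rho>. \<rho> \<in> R \<Longrightarrow> fourier G h \<rho> = 0\<^sub>m (rep_dim G \<rho>) (rep_dim G \<rho>)"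
    and irr: "irreducible_rep G \<sigma>"
  shows "(\<Sum>x\<in>carrier G. mat_trace (\<sigma> x) * h x) = 0"
proof -
  from R irr obtain \<rho> where \<rho>: "\<rho> \<in> R" "equivalent_reps G \<sigma> \<rho>"
    unfolding complete_unitary_irreps_def by blast
  let ?n = "rep_dim G \<rho>"
  have rep: "matrix_rep G \<rho>"
    using R \<rho> unfolding complete_unitary_irreps_def irreducible_rep_def by blast
  from \<rho>(2) obtain P Q where wit: "\<And>x. x \<in> carrier G \<Longrightarrow> similar_mat_wit (\<sigma> x) (\<rho> x) P Q"
    unfolding equivalent_reps_def by blast
  have tr: "mat_trace (\<sigma> x) = (\<Sum>i<?n. \<rho> x $$ (i, i))" if x: "x \<in> carrier G" for x
  proof -
    \<comment> \<open>\<open>similar_mat_wit\<close> takes the common size of its matrices from its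
      first argument.\<close>
    define m where "m = dim_row (\<sigma> x)"
    have w: "\<rho> x \<in> carrier_mat m m" "P \<in> carrier_mat m m" "Q \<in> carrier_mat m m"
      "Q * P = 1\<^sub>m m" "\<sigma> x = P * \<rho> x * Q"
      using wit[OF x] unfolding similar_mat_wit_def Let_def m_def[symmetric] by blast+
    have "mat_trace (\<sigma> x) = mat_trace (\<rho> x)"
      unfolding w(5) by (rule mat_trace_conj[OF w(1-4)])
    thus ?thesis using matrix_repD(1)[OF G rep x] by (auto simp: mat_trace_def)
  qed
  have "(\<Sum>x\<in>carrier G. mat_trace (\<sigma> x) * h x) = (\<Sum>i<?n. \<Sum>x\<in>carrier G. \<rho> x $$ (i, i) * h x)"
    by (subst sum.swap) (simp add: tr sum_distrib_right)
  also have "\<dots> = (\<Sum>i<?n. fourier G h \<rho> $$ (i, i))"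
    by (simp add: fourier_def)
  also have "\<dots> = 0" using zero[OF \<rho>(1)] by simp
  finally show ?thesis .
qed

text \<open>The trace of a reducible representation is the sum of the traces of a subrepresentation
  and the quotient, so an invariant complement is not needed.\<close>

lemma trace_sum_matrix_rep:
  assumes G: "group G" and R: "complete_unitary_irreps G R"
    and zero: "\<And>\<rho>. \<rho> \<in> R \<Longrightarrow> fourier G h \<rho> = 0\<^sub>m (rep_dim G \<rho>) (rep_dim G \<rho>)"
    and rep: "matrix_rep G \<sigma>"
  shows "(\<Sum>x\<in>carrier G. mat_trace (\<sigma> x) * h x) = 0"
  using rep
proof (induction "rep_dim G \<sigma>" arbitrary: \<sigma> rule: less_induct)
  case less
  define n where "n = rep_dim G \<sigma>"
  note r = matrix_repD[OF G less.prems, folded n_def]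
  \<comment> \<open>Irreducibility includes positive dimension, so dimension 0 is a separate case,
    in which the trace is an empty sum.\<close>
  consider "n = 0" | "irreducible_rep G \<sigma>" | W where "n > 0"
    "VectorSpace.subspace class_ring W (module_vec TYPE(complex) n)"
    "\<And>x v. x \<in> carrier G \<Longrightarrow> v \<in> W \<Longrightarrow> \<sigma> x *\<^sub>v v \<in> W"
    "W \<noteq> {0\<^sub>v n}" "W \<noteq> carrier_vec n"
    using less.prems unfolding irreducible_rep_def n_def by blast
  thus ?case
  proof cases
    case 1
    hence "mat_trace (\<sigma> x) = 0" if "x \<in> carrier G" for x
      using r(1)[OF that] by (simp add: mat_trace_def)
    thus ?thesis by simp
  next
    case 2
    show ?thesis by (rule trace_sum_irreducible[OF G R zero 2])
  next
    case 3
    obtain P Q J where PQ: "P \<in> carrier_mat n n" "Q \<in> carrier_mat n n"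
      "P * Q = 1\<^sub>m n" "Q * P = 1\<^sub>m n" and J: "J \<subseteq> {..<n}"
      and W: "W = {v \<in> carrier_vec n. \<forall>i<n. i \<notin> J \<longrightarrow> (Q *\<^sub>v v) $ i = 0}"
      using obtain_adapted_basis[OF 3(2)] by blast
    define M where "M x = Q * \<sigma> x * P" for x
    note M = matrix_rep_conj[OF G less.prems n_def[symmetric] PQ, folded M_def]
    note Mc = matrix_repD(1)[OF G M(1), unfolded M(2)]
    \<comment> \<open>The columns of \<open>P\<close> with index in \<open>J\<close> lie in the
      invariant subspace \<open>W\<close>. In the new basis every \<open>M x\<close> is therefore
      block triangular.\<close>
    have block: "M x $$ (i, j) = 0" if x: "x \<in> carrier G" and i: "i < n" "i \<notin> J" and j: "j \<in> J"
      for x i j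
    proof -
      have jn: "j < n" using j J by auto
      have colP: "col P j \<in> carrier_vec n" using PQ(1) jn by auto
      have "Q *\<^sub>v col P j = col (1\<^sub>m n) j"
        using col_mult2[OF PQ(2,1) jn] PQ(4) by simp
      hence "col P j \<in> W"
        using colP jn j by (auto simp: W)
      hence "\<sigma> x *\<^sub>v col P j \<in> W" using 3(3) x by blast
      hence "(Q *\<^sub>v (\<sigma> x *\<^sub>v col P j)) $ i = 0" using i by (simp add: W)
      moreover have "Q *\<^sub>v (\<sigma> x *\<^sub>v col P j) = col (M x) j"
        using assoc_mult_mat_vec[OF PQ(2) r(1)[OF x] colP]
          col_mult2[OF mult_carrier_mat[OF PQ(2) r(1)[OF x]] PQ(1) jn]
        by (simp add: M_def)
      ultimately show ?thesis using i jn Mc[OF x] by simp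
    qed
    let ?K = "{..<n} - J"
    \<comment> \<open>Since \<open>W\<close> is neither zero nor the whole space, both
      \<open>J\<close> and its complement are proper subsets of \<open>{..<n}\<close>, so the
      induction hypothesis applies to both blocks.\<close>
    have "J \<noteq> {}"
    proof
      assume [simp]: "J = {}"
      have "v = 0\<^sub>v n" if "v \<in> W" for v
      proof -
        have v: "v \<in> carrier_vec n" "\<And>i. i < n \<Longrightarrow> (Q *\<^sub>v v) $ i = 0" using that by (auto simp: W)
        have "Q *\<^sub>v v = 0\<^sub>v n" using v PQ(2) by (intro eq_vecI) auto
        moreover have "P *\<^sub>v 0\<^sub>v n = 0\<^sub>v n" using PQ(1) by (intro eq_vecI) auto
        ultimately have "(P * Q) *\<^sub>v v = 0\<^sub>v n"
          using assoc_mult_mat_vec[OF PQ(1,2) v(1)] by simp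
        thus ?thesis using PQ v by simp
      qed
      thus False using 3(4) subspace_module_vecD(2)[OF 3(2)] by blast
    qed
    moreover have "J \<noteq> {..<n}" using 3(5) by (auto simp: W)
    ultimately have card: "card J < n" "card ?K < n"
      using J psubset_card_mono[of "{..<n}" J] psubset_card_mono[of "{..<n}" ?K] by auto
    \<comment> \<open>\<open>\<alpha>\<close> is the action on \<open>W\<close>, in the basis of the
      columns with index in \<open>J\<close>.\<close>
    obtain \<alpha> where \<alpha>: "matrix_rep G \<alpha>" "rep_dim G \<alpha> = card J"
      "\<And>x. x \<in> carrier G \<Longrightarrow> mat_trace (\<alpha> x) = (\<Sum>i\<in>J. M x $$ (i, i))"
    proof (rule matrix_rep_compress[OF G M J])
      show "M x $$ (i, l) * M y $$ (l, j) = 0"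
        if "y \<in> carrier G" "j \<in> J" "l < n" "l \<notin> J" for x y i j l
        using block that by simp
    qed (rule that)
    \<comment> \<open>\<open>\<beta>\<close> is the action on the quotient by
      \<open>W\<close>.\<close>
    obtain \<beta> where \<beta>: "matrix_rep G \<beta>" "rep_dim G \<beta> = card ?K"
      "\<And>x. x \<in> carrier G \<Longrightarrow> mat_trace (\<beta> x) = (\<Sum>i\<in>?K. M x $$ (i, i))"
    proof (rule matrix_rep_compress[OF G M Diff_subset])
      show "M x $$ (i, l) * M y $$ (l, j) = 0"
        if "x \<in> carrier G" "i \<in> ?K" "l < n" "l \<notin> ?K" for x y i j l
        using block that by simp
    qed (rule that)
    have "mat_trace (\<sigma> x) = mat_trace (\<alpha> x) + mat_trace (\<beta> x)" if x: "x \<in> carrier G" for x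
    proof -
      have "mat_trace (\<sigma> x) = mat_trace (M x)"
        unfolding M_def by (rule mat_trace_conj[OF r(1)[OF x] PQ(2,1,3), symmetric])
      also have "\<dots> = (\<Sum>i<n. M x $$ (i, i))" using Mc[OF x] by (auto simp: mat_trace_def)
      also have "\<dots> = (\<Sum>i\<in>?K. M x $$ (i, i)) + (\<Sum>i\<in>J. M x $$ (i, i))"
        by (rule sum.subset_diff[OF J]) simp
      finally show ?thesis using \<alpha>(3) \<beta>(3) x by simp
    qed
    moreover have "(\<Sum>x\<in>carrier G. mat_trace (\<alpha> x) * h x) = 0"
      "(\<Sum>x\<in>carrier G. mat_trace (\<beta> x) * h x) = 0"
      using less.hyps[OF _ \<alpha>(1)] less.hyps[OF _ \<beta>(1)] card
      unfolding \<alpha>(2) \<beta>(2) n_def[symmetric] by blast+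
    moreover have "(\<Sum>x\<in>carrier G. mat_trace (\<sigma> x) * h x) =
        (\<Sum>x\<in>carrier G. mat_trace (\<alpha> x) * h x) + (\<Sum>x\<in>carrier G. mat_trace (\<beta> x) * h x)"
      unfolding sum.distrib[symmetric]
      by (intro sum.cong refl) (simp only: calculation distrib_right)
    ultimately show ?thesis by simp
  qed
qed

text \<open>This is the left regular representation by permutation matrices. Its trace counts the
  fixed points of left multiplication by \<open>x\<close>, and there are none unless
  \<open>x\<close> is the identity.\<close>

lemma obtain_regular_rep:
  assumes G: "group G" and fin: "finite (carrier G)"
  obtains \<sigma> where "matrix_rep G \<sigma>"
    "\<And>x. x \<in> carrier G \<Longrightarrow>
      mat_trace (\<sigma> x) = (if x = \<one>\<^bsub>G\<^esub> then of_nat (card (carrier G)) else 0)"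
proof -
  interpret group G by fact
  let ?n = "card (carrier G)"
  obtain e where e: "bij_betw e {..<?n} (carrier G)"
    using ex_bij_betw_nat_finite[OF fin] by (auto simp: atLeast0LessThan)
  have eG: "e a \<in> carrier G" if "a < ?n" for a
    using e that unfolding bij_betw_def by auto
  have inj: "e a = e b \<longleftrightarrow> a = b" if "a < ?n" "b < ?n" for a b
    using e that unfolding bij_betw_def inj_on_def by auto
  define \<sigma> :: "'a \<Rightarrow> complex mat" where
    "\<sigma> x = mat ?n ?n (\<lambda>(a, b). if e a = x \<otimes>\<^bsub>G\<^esub> e b then 1 else 0)" for x
  have mult: "\<sigma> (x \<otimes>\<^bsub>G\<^esub> y) = \<sigma> x * \<sigma> y" if xy: "x \<in> carrier G" "y \<in> carrier G" for x y
  proof (rule eq_matI)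
    fix a b assume "a < dim_row (\<sigma> x * \<sigma> y)" "b < dim_col (\<sigma> x * \<sigma> y)"
    hence ab: "a < ?n" "b < ?n" by (auto simp: \<sigma>_def)
    have "(\<sigma> x * \<sigma> y) $$ (a, b) = (\<Sum>c<?n. \<sigma> x $$ (a, c) * \<sigma> y $$ (c, b))"
      using ab by (intro index_mult_mat_sum) (auto simp: \<sigma>_def)
    also have "\<dots> = (\<Sum>c<?n. (if e a = x \<otimes>\<^bsub>G\<^esub> e c then 1 else 0) *
        (if e c = y \<otimes>\<^bsub>G\<^esub> e b then 1 else 0))"
      using ab by (intro sum.cong) (auto simp: \<sigma>_def)
    also have "\<dots> = (\<Sum>w\<in>carrier G. (if e a = x \<otimes>\<^bsub>G\<^esub> w then 1 else 0) *
        (if w = y \<otimes>\<^bsub>G\<^esub> e b then 1 else 0))"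
      by (rule sum.reindex_bij_betw[OF e])
    also have "\<dots> = (if e a = x \<otimes>\<^bsub>G\<^esub> (y \<otimes>\<^bsub>G\<^esub> e b) then 1 else 0)"
      using fin xy eG[OF ab(2)] by (simp add: if_distrib[of "\<lambda>t. _ * t"] cong: if_cong)
    also have "\<dots> = \<sigma> (x \<otimes>\<^bsub>G\<^esub> y) $$ (a, b)"
      using ab xy eG by (simp add: \<sigma>_def m_assoc)
    finally show "\<sigma> (x \<otimes>\<^bsub>G\<^esub> y) $$ (a, b) = (\<sigma> x * \<sigma> y) $$ (a, b)" ..
  qed (auto simp: \<sigma>_def)
  have one: "\<sigma> \<one>\<^bsub>G\<^esub> = 1\<^sub>m ?n"
    using inj eG by (intro eq_matI) (auto simp: \<sigma>_def)
  have tr: "mat_trace (\<sigma> x) = (if x = \<one>\<^bsub>G\<^esub> then of_nat ?n else 0)" if x: "x \<in> carrier G" for x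
  proof -
    have "e a = x \<otimes>\<^bsub>G\<^esub> e a \<longleftrightarrow> x = \<one>\<^bsub>G\<^esub>" if "a < ?n" for a
      using eG[OF that] x r_cancel_one' by auto
    thus ?thesis by (simp add: mat_trace_def \<sigma>_def)
  qed
  show ?thesis
    using that[of \<sigma>] tr matrix_repI[OF G, of \<sigma> ?n] one mult by (auto simp: \<sigma>_def)
qed

text \<open>The regular character pairs with a function to give the group order times its value at
  the identity. Translating \<open>h\<close> by \<open>t\<close> brings \<open>h t\<close> to the
  identity, and the translate still has vanishing Fourier transform.\<close>

lemma fourier_eq_zeroD:
  assumes G: "group G" and fin: "finite (carrier G)" and R: "complete_unitary_irreps G R"
    and zero: "\<And>\<rho>. \<rho> \<in> R \<Longrightarrow> fourier G h \<rho> = 0\<^sub>m (rep_dim G \<rho>) (rep_dim G \<rho>)"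
    and t: "t \<in> carrier G"
  shows "h t = 0"
proof -
  interpret group G by fact
  \<comment> \<open>With the point mass at \<open>t\<close>, the translate takes the form required
    by the convolution theorem.\<close>
  define a :: "'a \<Rightarrow> complex" where "a x = (if x = t then 1 else 0)" for x
  define g where "g u = (\<Sum>x\<in>carrier G. a x * h (x \<otimes>\<^bsub>G\<^esub> u))" for u
  have g: "g u = h (t \<otimes>\<^bsub>G\<^esub> u)" for u
    using fin t by (simp add: g_def a_def if_distrib[of "\<lambda>c. c * _"] cong: if_cong)
  have "fourier G g \<rho> = 0\<^sub>m (rep_dim G \<rho>) (rep_dim G \<rho>)" if \<rho>: "\<rho> \<in> R" for \<rho>
  proof -
    have rep: "matrix_rep G \<rho>"
      using R \<rho> unfolding complete_unitary_irreps_def irreducible_rep_def by blast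
    show ?thesis
      unfolding g_def fourier_convolution[OF G rep] zero[OF \<rho>]
      by (rule right_mult_zero_mat[OF fourier_carrier])
  qed
  moreover obtain \<sigma> where \<sigma>: "matrix_rep G \<sigma>" "\<And>x. x \<in> carrier G \<Longrightarrow>
      mat_trace (\<sigma> x) = (if x = \<one>\<^bsub>G\<^esub> then of_nat (card (carrier G)) else 0)"
    using obtain_regular_rep[OF G fin] by blast
  ultimately have "0 = (\<Sum>x\<in>carrier G. mat_trace (\<sigma> x) * g x)"
    using trace_sum_matrix_rep[OF G R, of g \<sigma>] by simp
  also have "\<dots> = (\<Sum>x\<in>carrier G. if x = \<one>\<^bsub>G\<^esub> then of_nat (card (carrier G)) * g \<one>\<^bsub>G\<^esub> else 0)"
    by (intro sum.cong) (auto simp: \<sigma>(2))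
  also have "\<dots> = of_nat (card (carrier G)) * h t"
    using fin t by (simp add: g)
  finally show ?thesis using fin by (auto simp: card_eq_0_iff)
qed

subsection \<open>Trilinear forms\<close>

text \<open>The left side depends on \<open>F\<close> only through the triple sums of its columns.
  Equality of these sums for two kernels therefore persists when both are multiplied on the right by
  the same kernel.\<close>

lemma triple_sum_expand:
  fixes F :: "'a \<Rightarrow> 'b \<Rightarrow> complex"
  shows "(\<Sum>x\<in>X. cnj (\<Sum>z\<in>Z. F x z * a z) * cnj (\<Sum>w\<in>Z. F x w * b w) * (\<Sum>u\<in>Z. F x u * c u)) =
    (\<Sum>z\<in>Z. \<Sum>w\<in>Z. \<Sum>u\<in>Z. cnj (a z) * cnj (b w) * c u *
      (\<Sum>x\<in>X. cnj (F x z) * cnj (F x w) * F x u))"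
proof -
  have "cnj (\<Sum>z\<in>Z. F x z * a z) * cnj (\<Sum>w\<in>Z. F x w * b w) * (\<Sum>u\<in>Z. F x u * c u) =
      (\<Sum>z\<in>Z. \<Sum>w\<in>Z. \<Sum>u\<in>Z. cnj (a z) * cnj (b w) * c u * (cnj (F x z) * cnj (F x w) * F x u))" for x
    unfolding cnj_sum mult.assoc sum_distrib_right unfolding sum_distrib_left
    by (simp add: mult_ac)
  hence "(\<Sum>x\<in>X. cnj (\<Sum>z\<in>Z. F x z * a z) * cnj (\<Sum>w\<in>Z. F x w * b w) * (\<Sum>u\<in>Z. F x u * c u)) =
      (\<Sum>x\<in>X. \<Sum>z\<in>Z. \<Sum>w\<in>Z. \<Sum>u\<in>Z.
        cnj (a z) * cnj (b w) * c u * (cnj (F x z) * cnj (F x w) * F x u))"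
    by simp
  also have "\<dots> = (\<Sum>z\<in>Z. \<Sum>x\<in>X. \<Sum>w\<in>Z. \<Sum>u\<in>Z.
        cnj (a z) * cnj (b w) * c u * (cnj (F x z) * cnj (F x w) * F x u))"
    by (rule sum.swap)
  also have "\<dots> = (\<Sum>z\<in>Z. \<Sum>w\<in>Z. \<Sum>x\<in>X. \<Sum>u\<in>Z.
        cnj (a z) * cnj (b w) * c u * (cnj (F x z) * cnj (F x w) * F x u))"
    by (intro sum.cong refl sum.swap)
  also have "\<dots> = (\<Sum>z\<in>Z. \<Sum>w\<in>Z. \<Sum>u\<in>Z. \<Sum>x\<in>X.
        cnj (a z) * cnj (b w) * c u * (cnj (F x z) * cnj (F x w) * F x u))"
    by (intro sum.cong refl sum.swap)
  finally show ?thesis by (simp only: sum_distrib_left)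
qed

text \<open>Taking norms shows that \<open>a\<close> has norm 1, so \<open>a * cnj a = 1\<close> and
  the product collapses to \<open>cnj a\<close>. Without the conjugates only a cube root of unity
  would result.\<close>

lemma complex_eq_1_if_cube:
  fixes a :: complex
  assumes "cnj a * cnj a * a = 1"
  shows "a = 1"
proof -
  have "norm a ^ 3 = 1"
    using arg_cong[OF assms, of norm] by (simp add: norm_mult power3_eq_cube)
  hence "norm a = 1" using power_eq_imp_eq_base[of "norm a" 3 1] by simp
  hence "a * cnj a = 1" by (simp add: complex_norm_square[symmetric])
  moreover have "cnj a * (a * cnj a) = 1" using assms by (simp only: mult_ac)
  ultimately have "cnj a = 1" by simp
  thus ?thesis by (metis complex_cnj_cnj complex_cnj_one)
qed

text \<open>The identities \<open>diag\<close> make the columns of \<open>A\<close> independent, so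
  the rows have a dual system \<open>B\<close>. Contracting \<open>diag\<close> with
  \<open>B\<close> isolates one row: products of two different entries vanish, so exactly one entry
  is nonzero, and it satisfies the cubic equation above.\<close>

lemma diagonal_triple_row:
  fixes A :: "'a \<Rightarrow> 'a \<Rightarrow> complex"
  assumes fin: "finite X"
    and diag: "\<And>p q r. \<lbrakk>p \<in> X; q \<in> X; r \<in> X\<rbrakk> \<Longrightarrow>
      (\<Sum>x\<in>X. cnj (A x p) * cnj (A x q) * A x r) = (if p = q \<and> q = r then 1 else 0)"
    and y: "y \<in> X"
  obtains p where "p \<in> X" "A y p = 1" "\<And>q. q \<in> X \<Longrightarrow> q \<noteq> p \<Longrightarrow> A y q = 0"
proof -
  obtain B where
    B: "\<And>x z. x \<in> X \<Longrightarrow> z \<in> X \<Longrightarrow> (\<Sum>r\<in>X. B x r * A z r) = (if x = z then 1 else 0)"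
  proof (rule kernel_trivial_obtain_inverse[OF fin, of "\<lambda>r x. A x r"])
    fix a p assume a: "\<And>x. x \<in> X \<Longrightarrow> (\<Sum>r\<in>X. a r * A x r) = 0" and p: "p \<in> X"
    \<comment> \<open>Pairing the relation with the squared conjugate of column \<open>p\<close>
      leaves only the coefficient \<open>a p\<close>.\<close>
    have "0 = (\<Sum>x\<in>X. cnj (A x p) * cnj (A x p) * (\<Sum>r\<in>X. a r * A x r))" using a by simp
    also have "\<dots> = (\<Sum>r\<in>X. a r * (\<Sum>x\<in>X. cnj (A x p) * cnj (A x p) * A x r))"
      unfolding sum_distrib_left by (subst sum.swap) (simp add: mult_ac)
    also have "\<dots> = (\<Sum>r\<in>X. if r = p then a r else 0)"
      using p by (intro sum.cong) (auto simp: diag)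
    finally show "a p = 0" using fin p by simp
  qed (rule that)
  have AB: "cnj (A y p) * cnj (A y q) = (if p = q then B y p else 0)"
    if pq: "p \<in> X" "q \<in> X" for p q
  proof -
    \<comment> \<open>Weighting \<open>diag\<close> with \<open>B y r\<close> and summing over
      \<open>r\<close> removes all \<open>x\<close> other than \<open>y\<close>.\<close>
    have "(if p = q then B y p else 0) =
        (\<Sum>r\<in>X. B y r * (\<Sum>x\<in>X. cnj (A x p) * cnj (A x q) * A x r))"
      using pq fin by (simp add: diag if_distrib[of "\<lambda>t. _ * t"] cong: if_cong)
    also have "\<dots> = (\<Sum>x\<in>X. cnj (A x p) * cnj (A x q) * (\<Sum>r\<in>X. B y r * A x r))"
      unfolding sum_distrib_left by (subst sum.swap) (simp add: mult_ac)
    also have "\<dots> = (\<Sum>x\<in>X. if x = y then cnj (A x p) * cnj (A x q) else 0)"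
      using y by (intro sum.cong) (auto simp: B)
    finally show ?thesis using fin y by simp
  qed
  have one: "(\<Sum>r\<in>X. B y r * A y r) = 1" using B[OF y y] by simp
  then obtain p where p: "p \<in> X" "A y p \<noteq> 0"
    by (metis (no_types, lifting) mult_zero_right sum.neutral zero_neq_one)
  have off: "A y q = 0" if "q \<in> X" "q \<noteq> p" for q
    using AB[OF p(1) that(1)] that(2) p(2) by auto
  \<comment> \<open>Only the term at \<open>p\<close> survives, and there \<open>B y p\<close> is
    the square of \<open>cnj (A y p)\<close> by \<open>AB\<close>.\<close>
  have "(\<Sum>r\<in>X. B y r * A y r) = (\<Sum>r\<in>X. if r = p then B y r * A y r else 0)"
    using off by (intro sum.cong) auto
  hence "cnj (A y p) * cnj (A y p) * A y p = 1"
    using one fin p(1) AB[OF p(1) p(1)] by simp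
  hence "A y p = 1" by (rule complex_eq_1_if_cube)
  with p(1) off show ?thesis using that by blast
qed


subsection \<open>Skew spectra\<close>

text \<open>By the convolution theorem, a relation among the translates of \<open>f\<close> says
  that the transform of \<open>?b\<close> times that of \<open>f\<close> is zero. Cancelling the
  invertible factor and using injectivity gives \<open>?b = 0\<close> on the group.\<close>

lemma fourier_invertible_imp_translates_independent:
  assumes G: "group G" and fin: "finite (carrier G)" and R: "complete_unitary_irreps G R"
    and inv: "\<And>\<rho>. \<rho> \<in> R \<Longrightarrow> invertible_mat (fourier G f \<rho>)"
    and zero: "\<And>u. u \<in> carrier G \<Longrightarrow> (\<Sum>x\<in>carrier G. a x * f (x \<otimes>\<^bsub>G\<^esub> u)) = 0"
    and x: "x \<in> carrier G"
  shows "a x = 0"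
proof -
  interpret group G by fact
  let ?b = "\<lambda>x. a (inv\<^bsub>G\<^esub> x)"
  have "fourier G ?b \<rho> = 0\<^sub>m (rep_dim G \<rho>) (rep_dim G \<rho>)" if \<rho>: "\<rho> \<in> R" for \<rho>
  proof -
    let ?n = "rep_dim G \<rho>"
    have rep: "matrix_rep G \<rho>"
      using R \<rho> unfolding complete_unitary_irreps_def irreducible_rep_def by blast
    note c = fourier_carrier[of G _ \<rho>]
    obtain B where B: "fourier G f \<rho> * B = 1\<^sub>m ?n" "B * fourier G f \<rho> = 1\<^sub>m (dim_row B)"
      using inv[OF \<rho>] c[of f] unfolding invertible_mat_def inverts_mat_def by auto
    \<comment> \<open>\<open>invertible_mat\<close> does not fix the shape of \<open>B\<close>: its
      column count comes from the first product, its row count from the second.\<close>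
    have Bc: "B \<in> carrier_mat ?n ?n"
      using arg_cong[OF B(1), of dim_col] arg_cong[OF B(2), of dim_col] c[of f] by auto
    have "fourier G ?b \<rho> * fourier G f \<rho> =
        fourier G (\<lambda>u. \<Sum>x\<in>carrier G. a x * f (x \<otimes>\<^bsub>G\<^esub> u)) \<rho>"
      by (rule fourier_convolution[OF G rep, symmetric])
    also have "\<dots> = 0\<^sub>m ?n ?n"
      by (rule eq_matI) (auto simp: fourier_def zero)
    finally have "fourier G ?b \<rho> * fourier G f \<rho> * B = 0\<^sub>m ?n ?n"
      using Bc by simp
    thus ?thesis
      using assoc_mult_mat[OF c[of ?b] c[of f] Bc] B(1) right_mult_one_mat[OF c[of ?b]] by simp
  qed
  from fourier_eq_zeroD[OF G fin R this, of "inv\<^bsub>G\<^esub> x"] x show ?thesis by simp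
qed

text \<open>Injectivity, applied to the difference of the two triple correlations, settles the sums
  in which one of the three shifts is the identity. Replacing \<open>x\<close> by \<open>x z\<close>
  brings an arbitrary triple of shifts to that form.\<close>

lemma skew_spectrum_eq_imp_triple_eq:
  assumes G: "group G" and fin: "finite (carrier G)" and R: "complete_unitary_irreps G R"
    and eq: "\<And>z \<rho>. z \<in> carrier G \<Longrightarrow> \<rho> \<in> R \<Longrightarrow> skew_spectrum G f' z \<rho> = skew_spectrum G f z \<rho>"
    and z: "z \<in> carrier G" and w: "w \<in> carrier G" and u: "u \<in> carrier G"
  shows "(\<Sum>x\<in>carrier G. cnj (f' (x \<otimes>\<^bsub>G\<^esub> z)) * cnj (f' (x \<otimes>\<^bsub>G\<^esub> w)) * f' (x \<otimes>\<^bsub>G\<^esub> u)) =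
    (\<Sum>x\<in>carrier G. cnj (f (x \<otimes>\<^bsub>G\<^esub> z)) * cnj (f (x \<otimes>\<^bsub>G\<^esub> w)) * f (x \<otimes>\<^bsub>G\<^esub> u))"
proof -
  interpret group G by fact
  define T where "T g v u = (\<Sum>x\<in>carrier G. cnj (skew_product G g v x) * g (x \<otimes>\<^bsub>G\<^esub> u))"
    for g :: "'a \<Rightarrow> complex" and v u
  have "T f' v u = T f v u" if v: "v \<in> carrier G" and u: "u \<in> carrier G" for v u
  proof -
    have "fourier G (\<lambda>u. T f' v u - T f v u) \<rho> = 0\<^sub>m (rep_dim G \<rho>) (rep_dim G \<rho>)" if \<rho>: "\<rho> \<in> R" for \<rho>
    proof -
      have rep: "unitary_rep G \<rho>"
        using R \<rho> unfolding complete_unitary_irreps_def by blast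
      have "fourier G (\<lambda>u. T f' v u - T f v u) \<rho> = fourier G (T f' v) \<rho> - fourier G (T f v) \<rho>"
        by (rule eq_matI) (auto simp: fourier_def right_diff_distrib sum_subtractf)
      also have "fourier G (T f' v) \<rho> = fourier G (T f v) \<rho>"
        using eq[OF v \<rho>] by (simp add: skew_spectrum_eq_fourier[OF G rep] T_def[abs_def])
      finally show ?thesis using fourier_carrier[of G "T f v" \<rho>] by simp
    qed
    from fourier_eq_zeroD[OF G fin R this u] show ?thesis by simp
  qed
  moreover have "(\<Sum>x\<in>carrier G. cnj (g (x \<otimes>\<^bsub>G\<^esub> z)) * cnj (g (x \<otimes>\<^bsub>G\<^esub> w)) * g (x \<otimes>\<^bsub>G\<^esub> u)) =
      T g (inv\<^bsub>G\<^esub> z \<otimes>\<^bsub>G\<^esub> w) (inv\<^bsub>G\<^esub> z \<otimes>\<^bsub>G\<^esub> u)" for g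
  proof -
    have "bij_betw (\<lambda>x. x \<otimes>\<^bsub>G\<^esub> z) (carrier G) (carrier G)"
      using z by (intro bij_betwI[of _ _ _ "\<lambda>x. x \<otimes>\<^bsub>G\<^esub> inv\<^bsub>G\<^esub> z"]) (auto simp: m_assoc)
    hence "T g (inv\<^bsub>G\<^esub> z \<otimes>\<^bsub>G\<^esub> w) (inv\<^bsub>G\<^esub> z \<otimes>\<^bsub>G\<^esub> u) = (\<Sum>x\<in>carrier G.
        cnj (skew_product G g (inv\<^bsub>G\<^esub> z \<otimes>\<^bsub>G\<^esub> w) (x \<otimes>\<^bsub>G\<^esub> z)) *
        g (x \<otimes>\<^bsub>G\<^esub> z \<otimes>\<^bsub>G\<^esub> (inv\<^bsub>G\<^esub> z \<otimes>\<^bsub>G\<^esub> u)))"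
      unfolding T_def by (rule sum.reindex_bij_betw[symmetric])
    also have "\<dots> = (\<Sum>x\<in>carrier G.
        cnj (g (x \<otimes>\<^bsub>G\<^esub> z)) * cnj (g (x \<otimes>\<^bsub>G\<^esub> w)) * g (x \<otimes>\<^bsub>G\<^esub> u))"
    proof (intro sum.cong refl)
      fix x assume x: "x \<in> carrier G"
      have "x \<otimes>\<^bsub>G\<^esub> z \<otimes>\<^bsub>G\<^esub> (inv\<^bsub>G\<^esub> z \<otimes>\<^bsub>G\<^esub> v) = x \<otimes>\<^bsub>G\<^esub> v" if v: "v \<in> carrier G" for v
      proof -
        have "z \<otimes>\<^bsub>G\<^esub> (inv\<^bsub>G\<^esub> z \<otimes>\<^bsub>G\<^esub> v) = v" using m_assoc[of z "inv\<^bsub>G\<^esub> z" v] z v by simp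
        thus ?thesis using x z v by (simp add: m_assoc)
      qed
      thus "cnj (skew_product G g (inv\<^bsub>G\<^esub> z \<otimes>\<^bsub>G\<^esub> w) (x \<otimes>\<^bsub>G\<^esub> z)) *
          g (x \<otimes>\<^bsub>G\<^esub> z \<otimes>\<^bsub>G\<^esub> (inv\<^bsub>G\<^esub> z \<otimes>\<^bsub>G\<^esub> u)) =
        cnj (g (x \<otimes>\<^bsub>G\<^esub> z)) * cnj (g (x \<otimes>\<^bsub>G\<^esub> w)) * g (x \<otimes>\<^bsub>G\<^esub> u)"
        using w u by (simp add: skew_product_def)
    qed
    finally show ?thesis by simp
  qed
  ultimately show ?thesis using z w u by simp
qed

text \<open>In the triple correlation every argument has \<open>x\<close> as its left factor, so a
  left translation is absorbed by reindexing the sum over \<open>x\<close>.\<close>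

lemma skew_spectrum_translate:
  assumes G: "group G" and rep: "unitary_rep G \<rho>"
    and t: "t \<in> carrier G" and z: "z \<in> carrier G"
    and f': "\<And>x. x \<in> carrier G \<Longrightarrow> f' x = f (t \<otimes>\<^bsub>G\<^esub> x)"
  shows "skew_spectrum G f' z \<rho> = skew_spectrum G f z \<rho>"
  unfolding skew_spectrum_eq_fourier[OF G rep]
proof (rule fourier_cong)
  interpret group G by fact
  fix u assume u: "u \<in> carrier G"
  have left: "bij_betw (\<lambda>x. t \<otimes>\<^bsub>G\<^esub> x) (carrier G) (carrier G)"
    using t by (intro bij_betwI[of _ _ _ "\<lambda>x. inv\<^bsub>G\<^esub> t \<otimes>\<^bsub>G\<^esub> x"]) (auto simp: m_assoc[symmetric])
  show "(\<Sum>x\<in>carrier G. cnj (skew_product G f' z x) * f' (x \<otimes>\<^bsub>G\<^esub> u)) =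
      (\<Sum>x\<in>carrier G. cnj (skew_product G f z x) * f (x \<otimes>\<^bsub>G\<^esub> u))"
    unfolding sum.reindex_bij_betw[OF left, symmetric,
      of "\<lambda>x. cnj (skew_product G f z x) * f (x \<otimes>\<^bsub>G\<^esub> u)"]
    using t z u by (intro sum.cong) (auto simp: skew_product_def f' m_assoc)
qed

theorem theorem1:
  fixes G :: "('a, 'b) monoid_scheme"
    and R :: "('a \<Rightarrow> complex mat) set"
    and f f' :: "'a \<Rightarrow> complex"
  assumes "group G"
    and "finite (carrier G)"
    and "complete_unitary_irreps G R"
    and "\<And>\<rho>. \<rho> \<in> R \<Longrightarrow> invertible_mat (fourier G f \<rho>)"
  shows "(\<exists>t\<in>carrier G. \<forall>x\<in>carrier G. f' x = f (inv\<^bsub>G\<^esub> t \<otimes>\<^bsub>G\<^esub> x)) \<longleftrightarrow>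
         (\<forall>z\<in>carrier G. \<forall>\<rho>\<in>R. skew_spectrum G f' z \<rho> = skew_spectrum G f z \<rho>)"
proof
  interpret group G by fact
  assume "\<exists>t\<in>carrier G. \<forall>x\<in>carrier G. f' x = f (inv\<^bsub>G\<^esub> t \<otimes>\<^bsub>G\<^esub> x)"
  then obtain t where t: "t \<in> carrier G"
    "\<And>x. x \<in> carrier G \<Longrightarrow> f' x = f (inv\<^bsub>G\<^esub> t \<otimes>\<^bsub>G\<^esub> x)" by blast
  show "\<forall>z\<in>carrier G. \<forall>\<rho>\<in>R. skew_spectrum G f' z \<rho> = skew_spectrum G f z \<rho>"
  proof (intro ballI)
    fix z \<rho> assume z: "z \<in> carrier G" and "\<rho> \<in> R"
    hence rep: "unitary_rep G \<rho>" using assms(3) unfolding complete_unitary_irreps_def by blast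
    show "skew_spectrum G f' z \<rho> = skew_spectrum G f z \<rho>"
      by (rule skew_spectrum_translate[OF assms(1) rep inv_closed[OF t(1)] z])
        (erule t(2))
  qed
next
  interpret group G by fact
  let ?X = "carrier G"
  note fin = assms(2)
  assume eq: "\<forall>z\<in>?X. \<forall>\<rho>\<in>R. skew_spectrum G f' z \<rho> = skew_spectrum G f z \<rho>"
  \<comment> \<open>\<open>L\<close> is the two-sided inverse of the kernel \<open>f (x y)\<close>,
    whose rows are independent because all Fourier matrices are invertible.\<close>
  obtain L where
    L: "\<And>x y. x \<in> ?X \<Longrightarrow> y \<in> ?X \<Longrightarrow> (\<Sum>z\<in>?X. L x z * f (z \<otimes>\<^bsub>G\<^esub> y)) = (if x = y then 1 else 0)"
      "\<And>x y. x \<in> ?X \<Longrightarrow> y \<in> ?X \<Longrightarrow> (\<Sum>z\<in>?X. f (x \<otimes>\<^bsub>G\<^esub> z) * L z y) = (if x = y then 1 else 0)"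
    using kernel_trivial_obtain_inverse[OF fin, of "\<lambda>x u. f (x \<otimes>\<^bsub>G\<^esub> u)"]
      fourier_invertible_imp_translates_independent[OF assms] by blast
  \<comment> \<open>\<open>A\<close> is the transition kernel that expresses the translates of
    \<open>f'\<close> through those of \<open>f\<close>.\<close>
  define A where "A x p = (\<Sum>u\<in>?X. f' (x \<otimes>\<^bsub>G\<^esub> u) * L u p)" for x p
  have "(\<Sum>x\<in>?X. cnj (A x p) * cnj (A x q) * A x r) = (if p = q \<and> q = r then 1 else 0)"
    if pqr: "p \<in> ?X" "q \<in> ?X" "r \<in> ?X" for p q r
  proof -
    \<comment> \<open>Both sides expand with the same coefficients, built from \<open>L\<close>,
      into the triple sums of \<open>f'\<close> and of \<open>f\<close>, which agree.\<close>
    have "(\<Sum>x\<in>?X. cnj (A x p) * cnj (A x q) * A x r) =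
      (\<Sum>x\<in>?X. cnj (\<Sum>z\<in>?X. f (x \<otimes>\<^bsub>G\<^esub> z) * L z p) * cnj (\<Sum>w\<in>?X. f (x \<otimes>\<^bsub>G\<^esub> w) * L w q) *
        (\<Sum>u\<in>?X. f (x \<otimes>\<^bsub>G\<^esub> u) * L u r))"
      unfolding A_def triple_sum_expand using eq
      by (intro sum.cong refl) (simp add: skew_spectrum_eq_imp_triple_eq[OF assms(1-3), of f' f])
    \<comment> \<open>For \<open>f\<close> itself the inner sums are Kronecker deltas by
      \<open>L(2)\<close>.\<close>
    also have "\<dots> = (\<Sum>x\<in>?X. if x = p then (if p = q \<and> q = r then 1 else 0) else 0)"
      using pqr by (intro sum.cong) (auto simp: L)
    finally show ?thesis using fin pqr by simp
  qed
  \<comment> \<open>The row at the identity is enough, since it expresses \<open>f'\<close> itself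
    through the translates of \<open>f\<close>; its single entry 1 selects the translate by
    \<open>p\<close>.\<close>
  from diagonal_triple_row[OF fin this one_closed]
  obtain p where p: "p \<in> ?X" "A \<one>\<^bsub>G\<^esub> p = 1" "\<And>q. q \<in> ?X \<Longrightarrow> q \<noteq> p \<Longrightarrow> A \<one>\<^bsub>G\<^esub> q = 0"
    by blast
  have "f' v = f (p \<otimes>\<^bsub>G\<^esub> v)" if v: "v \<in> ?X" for v
  proof -
    have "f' v = (\<Sum>u\<in>?X. if u = v then f' u else 0)" using fin v by simp
    also have "\<dots> = (\<Sum>u\<in>?X. f' (\<one>\<^bsub>G\<^esub> \<otimes>\<^bsub>G\<^esub> u) * (\<Sum>z\<in>?X. L u z * f (z \<otimes>\<^bsub>G\<^esub> v)))"
      using v by (intro sum.cong) (auto simp: L)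
    also have "\<dots> = (\<Sum>z\<in>?X. A \<one>\<^bsub>G\<^esub> z * f (z \<otimes>\<^bsub>G\<^esub> v))"
      unfolding A_def sum_distrib_left sum_distrib_right
      by (subst sum.swap) (simp add: mult.assoc)
    also have "\<dots> = (\<Sum>z\<in>?X. if z = p then f (z \<otimes>\<^bsub>G\<^esub> v) else 0)"
      using p by (intro sum.cong) auto
    finally show ?thesis using fin p(1) by simp
  qed
  \<comment> \<open>The required form translates by the inverse of \<open>t\<close>, hence the
    witness is the inverse of \<open>p\<close>.\<close>
  thus "\<exists>t\<in>?X. \<forall>x\<in>?X. f' x = f (inv\<^bsub>G\<^esub> t \<otimes>\<^bsub>G\<^esub> x)"
    using p(1) by (intro bexI[of _ "inv\<^bsub>G\<^esub> p"]) auto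
qed

end
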